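(* Let $X^{\ast}$ be an optimal solution of $\min_{X} F(X)$ subject to $\operatorname{rank}(X)\le r$, where $y=\mathcal{A}(X^{\ast})$. Assume that the restricted isometry constant of $\mathcal{A}$ satisfies $\delta_{3r}\le \frac{1}{71}$, and that the step size $\eta$ satisfies $$\frac{6-6\delta_{3r}-\sqrt{71\delta_{3r}^{2}-72\delta_{3r}+1}}{12-12\delta_{3r}^{2}}<\eta<\frac{6-6\delta_{3r}+\sqrt{71\delta_{3r}^{2}-72\delta_{3r}+1}}{12-12\delta_{3r}^{2}}.$$ Set $$\rho_{3r}=2\sqrt{1-2(1-\delta_{3r})\left(2\eta-2\eta^{2}(1+\delta_{3r})\right)},\qquad \kappa_{3r}=\frac{-3\rho_{3r}^{n+1}+\rho_{3r}^{n}+2\rho_{3r}}{1-\rho_{3r}}.$$ Then $\kappa_{3r}<1$, and the outer iterates $\widetilde{X}_{k}$ of the SVRG-ARM algorithm with step size $\eta$ and $n\ge 1$ inner iterations converge linearly in expectation: for every $k\ge 0$, $$\mathbb{E}\|\widetilde{X}_{k}-X^{\ast}\|_{F}\le \kappa_{3r}^{k}\,\|\widetilde{X}_{0}-X^{\ast}\|_{F},$$ where the expectation is over all random index choices made by the algorithm.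
   Context: Setting. $A_1,\dots,A_m\in\mathbb{R}^{n_1\times n_2}$ are sensing matrices, $\langle\cdot,\cdot\rangle$ is the Frobenius inner product, $\mathcal{A}:\mathbb{R}^{n_1\times n_2}\to\mathbb{R}^m$ is $\mathcal{A}(X)=(\langle A_\ell,X\rangle)_{\ell=1}^m$, and $y=\mathcal{A}(X^{\ast})\in\mathbb{R}^m$ for a ground-truth matrix $X^{\ast}$ of rank at most $r$. The cost function is $F(X)=\frac1m\|y-\mathcal{A}(X)\|_2^2=\frac1m\sum_{\ell=1}^m (y_\ell-\langle A_\ell,X\rangle)^2$. A batch size $b\in\{1,\dots,m\}$ is fixed. For an index set $I\subseteq\{1,\dots,m\}$ with $|I|=b$, $\mathcal{A}_I(X)=(\langle A_\ell,X\rangle)_{\ell\in I}$ and $f_I(X)=\frac{1}{|I|}\sum_{\ell\in I}(y_\ell-\langle A_\ell,X\rangle)^2$. Restricted isometry constant. For an integer $1\le s\le\min(n_1,n_2)$, $\delta_s$ is the smallest number such that, for all matrices $X$ of rank at most $s$, $(1-\delta_s)\|X\|_F^2\le\frac1m\|\mathcal{A}(X)\|_2^2$, and $\frac{1}{|I|}\|\mathcal{A}_I(X)\|_2^2\le(1+\delta_s)\|X\|_F^2$ for every index set $I$ with $|I|=b$. (Here $3r\le\min(n_1,n_2)$.) SVRG-ARM algorithm. $\mathcal{H}_r(W)$ denotes a best approximation of $W$ in Frobenius norm among matrices of rank at most $r$ (truncated singular value decomposition). Start from a deterministic $\widetilde{X}_0$ with $\operatorname{rank}(\widetilde{X}_0)\le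 r$. For $k=0,1,2,\dots$: set $g_k=\nabla F(\widetilde{X}_k)$ and $X_0=\widetilde{X}_k$; for $t=0,\dots,n-1$, pick $i_t\subseteq\{1,\dots,m\}$, $|i_t|=b$, uniformly at random and independently of the past, set $W_t=X_t-\eta\left(\nabla f_{i_t}(X_t)-\nabla f_{i_t}(\widetilde{X}_k)+g_k\right)$ and $X_{t+1}=\mathcal{H}_r(W_t)$; finally set $\widetilde{X}_{k+1}=X_n$. The stopping test is ignored. *)

theory Defs
  imports "HOL-Analysis.Analysis" "HOL-Probability.Probability"
begin

text \<open>
  Matrices with n1 rows and n2 columns have type \<^typ>\<open>real^'n2^'n1\<close>. The library's inner product and
  norm on this nested vector type are the Frobenius inner product and the Frobenius norm.
\<close>

definition sensing_map :: "('m::finite \<Rightarrow> real^'n2^'n1) \<Rightarrow> real^'n2^'n1 \<Rightarrow> real^'m" where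
  "sensing_map A X = (\<chi> l. A l \<bullet> X)"

definition full_cost :: "('m::finite \<Rightarrow> real^'n2^'n1) \<Rightarrow> real^'m \<Rightarrow> real^'n2^'n1 \<Rightarrow> real" where
  "full_cost A y X = 1 / real CARD('m) * (norm (y - sensing_map A X))\<^sup>2"

definition batch_cost ::
    "('m::finite \<Rightarrow> real^'n2^'n1) \<Rightarrow> real^'m \<Rightarrow> 'm set \<Rightarrow> real^'n2^'n1 \<Rightarrow> real" where
  "batch_cost A y I X = 1 / real (card I) * (\<Sum>l\<in>I. (y $ l - A l \<bullet> X)\<^sup>2)"

definition batches :: "nat \<Rightarrow> 'm::finite set set" where
  "batches b = {I. card I = b}"

text \<open>
  In the upper bound, the sum over \<open>I\<close> is the squared Euclidean norm of the subvector of
  \<open>sensing_map A X\<close> indexed by \<open>I\<close>. The two bounds are deliberately asymmetric: the lower one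
  uses all measurements, the upper one every batch of size \<open>b\<close>.
\<close>

definition rip_bound :: "('m::finite \<Rightarrow> real^'n2^'n1) \<Rightarrow> nat \<Rightarrow> nat \<Rightarrow> real \<Rightarrow> bool" where
  "rip_bound A b s \<delta> \<longleftrightarrow>
     (\<forall>X. rank X \<le> s \<longrightarrow>
        (1 - \<delta>) * (norm X)\<^sup>2 \<le> 1 / real CARD('m) * (norm (sensing_map A X))\<^sup>2 \<and>
        (\<forall>I\<in>batches b.
           1 / real (card I) * (\<Sum>l\<in>I. (A l \<bullet> X)\<^sup>2) \<le> (1 + \<delta>) * (norm X)\<^sup>2))"

text \<open>
  The least element exists for \<open>s \<ge> 1\<close> and \<open>1 \<le> b \<le> CARD('m)\<close>: the admissible
  \<open>\<delta>\<close> form a closed nonempty set, bounded below by 0 since the average of the batch energies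
  over all batches is the normalised full energy.
\<close>

definition ric :: "('m::finite \<Rightarrow> real^'n2^'n1) \<Rightarrow> nat \<Rightarrow> nat \<Rightarrow> real" where
  "ric A b s = (LEAST \<delta>. rip_bound A b s \<delta>)"

definition grad :: "('a::real_inner \<Rightarrow> real) \<Rightarrow> 'a \<Rightarrow> 'a" where
  "grad f x = (THE D. GDERIV f x :> D)"

definition best_rank_approx :: "nat \<Rightarrow> real^'n2^'n1 \<Rightarrow> real^'n2^'n1 \<Rightarrow> bool" where
  "best_rank_approx r W Z \<longleftrightarrow> is_arg_min (\<lambda>Z. norm (W - Z)) (\<lambda>Z. rank Z \<le> r) Z"

text \<open>
  The iterates are given by their laws, which are finitely supported distributions on matrices.
  \<open>H\<close> is the hard thresholding map, \<open>Xt\<close> the current outer iterate. Each bind draws a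
  fresh batch, uniform and independent of everything drawn before.
\<close>

definition svrg_step ::
    "(real^'n2^'n1 \<Rightarrow> real^'n2^'n1) \<Rightarrow> ('m::finite \<Rightarrow> real^'n2^'n1) \<Rightarrow> real^'m \<Rightarrow> real \<Rightarrow>
     real^'n2^'n1 \<Rightarrow> 'm set \<Rightarrow> real^'n2^'n1 \<Rightarrow> real^'n2^'n1" where
  "svrg_step H A y \<eta> Xt I X =
     H (X - \<eta> *\<^sub>R (grad (batch_cost A y I) X - grad (batch_cost A y I) Xt
                   + grad (full_cost A y) Xt))"

primrec svrg_inner ::
    "(real^'n2^'n1 \<Rightarrow> real^'n2^'n1) \<Rightarrow> ('m::finite \<Rightarrow> real^'n2^'n1) \<Rightarrow> real^'m \<Rightarrow> nat \<Rightarrow> real \<Rightarrow>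
     real^'n2^'n1 \<Rightarrow> nat \<Rightarrow> (real^'n2^'n1) pmf" where
  "svrg_inner H A y b \<eta> Xt 0 = return_pmf Xt"
| "svrg_inner H A y b \<eta> Xt (Suc t) =
     bind_pmf (svrg_inner H A y b \<eta> Xt t)
       (\<lambda>X. map_pmf (\<lambda>I. svrg_step H A y \<eta> Xt I X) (pmf_of_set (batches b)))"

primrec svrg_arm ::
    "(real^'n2^'n1 \<Rightarrow> real^'n2^'n1) \<Rightarrow> ('m::finite \<Rightarrow> real^'n2^'n1) \<Rightarrow> real^'m \<Rightarrow> nat \<Rightarrow> real \<Rightarrow>
     nat \<Rightarrow> real^'n2^'n1 \<Rightarrow> nat \<Rightarrow> (real^'n2^'n1) pmf" where
  "svrg_arm H A y b \<eta> n X0 0 = return_pmf X0"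
| "svrg_arm H A y b \<eta> n X0 (Suc k) =
     bind_pmf (svrg_arm H A y b \<eta> n X0 k) (\<lambda>Xt. svrg_inner H A y b \<eta> Xt n)"

end

theory Submission
  imports Defs
begin

text \<open>
  Since \<open>H\<close> returns a best approximation, the new error \<open>D\<close> satisfies
  \<open>\<parallel>D\<parallel>\<^sup>2 \<le> 2 \<langle>D, W - Xs\<rangle>\<close>, where \<open>W - Xs\<close> is the sum of a batch gradient step applied to the current
  error, minus the same step applied to the outer error, plus a full gradient step applied to the
  outer error. On low-rank directions a batch step is bounded pointwise, and averaging over the
  batches gives the factor \<open>\<rho> / 2\<close> for each of the three terms. Hence the expected errors obey
  \<open>e\<^sub>t\<^sub>+\<^sub>1 \<le> \<rho> e\<^sub>t + 2 \<rho> e\<^sub>0\<close>, whose solution after \<open>n\<close> steps is \<open>\<kappa> e\<^sub>0\<close>. The step size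
  condition says exactly that \<open>\<rho> < 1 / 3\<close>, which is what makes \<open>\<kappa> < 1\<close>.
\<close>

section \<open>Rank of linear combinations\<close>

lemma rank_scaleR_le:
  fixes X :: "real^'n2^'n1"
  shows "rank (c *\<^sub>R X) \<le> rank X"
proof -
  have "range (\<lambda>x. (c *\<^sub>R X) *v x) \<subseteq> range (\<lambda>x. X *v x)"
    by (metis image_subset_iff matrix_vector_mult_scaleR rangeI scaleR_matrix_vector_assoc)
  then show ?thesis
    by (simp add: rank_dim_range dim_subset)
qed

lemma rank_add_le:
  fixes X Y :: "real^'n2^'n1"
  shows "rank (X + Y) \<le> rank X + rank Y"
proof -
  let ?S = "{x + y |x y. x \<in> range ((*v) X) \<and> y \<in> range ((*v) Y)}"
  have "range ((*v) (X + Y)) \<subseteq> ?S"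
    by (auto simp: matrix_vector_mult_add_rdistrib)
  then have "rank (X + Y) \<le> dim ?S"
    by (simp add: rank_dim_range dim_subset)
  also have "\<dots> \<le> rank X + rank Y"
    using dim_sums_Int[of "range ((*v) X)" "range ((*v) Y)"]
    by (simp add: rank_dim_range linear_subspace_image)
  finally show ?thesis .
qed

text \<open>Two differences with a common subtrahend still combine only three matrices of rank at
  most \<open>r\<close>. With \<open>W\<close> the ground truth, this is the source of the order
  \<open>3 * r\<close> of the isometry constant.\<close>

lemma rank_span_differences_le:
  fixes U V W :: "real^'n2^'n1"
  assumes "rank U \<le> r" "rank V \<le> r" "rank W \<le> r" and "Z \<in> span {U - W, V - W}"
  shows "rank Z \<le> 3 * r"
proof -
  obtain a b where "Z = a *\<^sub>R (U - W) + b *\<^sub>R (V - W)"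
    using assms(4) by (auto simp: span_insert span_singleton algebra_simps)
  then have "Z = (a *\<^sub>R U + b *\<^sub>R V) + (- a - b) *\<^sub>R W"
    by (simp add: algebra_simps)
  then have "rank Z \<le> rank (a *\<^sub>R U) + rank (b *\<^sub>R V) + rank ((- a - b) *\<^sub>R W)"
    using rank_add_le[of "a *\<^sub>R U + b *\<^sub>R V" "(- a - b) *\<^sub>R W"] rank_add_le[of "a *\<^sub>R U" "b *\<^sub>R V"]
    by simp
  then show ?thesis
    using assms(1-3) rank_scaleR_le[of a U] rank_scaleR_le[of b V] rank_scaleR_le[of "- a - b" W]
    by linarith
qed

section \<open>Gram operators of batches and gradients of the costs\<close>

text \<open>The normalised operator "adjoint of the batch map after the batch map". Its quadratic
  form is the batch energy in \<open>rip_bound\<close>; for \<open>UNIV\<close> it is the full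
  energy.\<close>

definition batch_gram :: "('m::finite \<Rightarrow> real^'n2^'n1) \<Rightarrow> 'm set \<Rightarrow> real^'n2^'n1 \<Rightarrow> real^'n2^'n1" where
  "batch_gram A I X = (1 / real (card I)) *\<^sub>R (\<Sum>l\<in>I. (A l \<bullet> X) *\<^sub>R A l)"

lemma batch_gram_inner:
  "batch_gram A I X \<bullet> Y = 1 / real (card I) * (\<Sum>l\<in>I. (A l \<bullet> X) * (A l \<bullet> Y))"
  by (simp add: batch_gram_def inner_sum_left)

lemma batch_gram_inner_self:
  "batch_gram A I X \<bullet> X = 1 / real (card I) * (\<Sum>l\<in>I. (A l \<bullet> X)\<^sup>2)"
  by (simp add: batch_gram_inner power2_eq_square)

lemma batch_gram_nonneg: "0 \<le> batch_gram A I X \<bullet> X"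
  by (simp add: batch_gram_inner_self sum_nonneg)

lemma batch_gram_cauchy_schwarz:
  "(batch_gram A I X \<bullet> Y)\<^sup>2 \<le> (batch_gram A I X \<bullet> X) * (batch_gram A I Y \<bullet> Y)"
proof -
  have "(\<Sum>l\<in>I. (A l \<bullet> X) * (A l \<bullet> Y))\<^sup>2 \<le> (\<Sum>l\<in>I. (A l \<bullet> X)\<^sup>2) * (\<Sum>l\<in>I. (A l \<bullet> Y)\<^sup>2)"
    by (rule Cauchy_Schwarz_ineq_sum)
  from mult_left_mono[OF this, of "(1 / real (card I))\<^sup>2"] show ?thesis
    by (simp add: batch_gram_inner power2_eq_square field_simps)
qed

lemma power2_norm_vec: "(norm v)\<^sup>2 = (\<Sum>l\<in>UNIV. (v $ l)\<^sup>2)" for v :: "real^'m"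
  by (simp add: norm_vec_def L2_set_def sum_nonneg)

lemma norm_sensing_map_eq:
  "1 / real CARD('m) * (norm (sensing_map A X))\<^sup>2 = batch_gram (A :: 'm::finite \<Rightarrow> _) UNIV X \<bullet> X"
  by (simp add: batch_gram_inner_self sensing_map_def power2_norm_vec)

lemma grad_eqI:
  assumes "GDERIV f x :> D"
  shows "grad f x = D"
  unfolding grad_def
proof (rule the_equality[where P = "\<lambda>D. GDERIV f x :> D", OF assms])
  fix E assume "GDERIV f x :> E"
  with assms have "(\<lambda>h. h \<bullet> E) = (\<lambda>h. h \<bullet> D)"
    unfolding gderiv_def by (metis has_derivative_unique)
  then show "E = D"
    by (metis vector_eq_ldot)
qed

text \<open>Since the data are exact, the residuals are linear in \<open>X - Xs\<close>, and so is
  the gradient: every step acts directly on the error.\<close>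

lemma grad_batch_cost:
  "grad (batch_cost A (sensing_map A Xs) I) X = 2 *\<^sub>R batch_gram A I (X - Xs)"
proof (rule grad_eqI)
  have "((\<lambda>X. (A l \<bullet> Xs - A l \<bullet> X)\<^sup>2) has_derivative (\<lambda>h. 2 * (A l \<bullet> (X - Xs)) * (A l \<bullet> h))) (at X)" for l
    by (rule has_derivative_eq_rhs, (rule derivative_intros)+)
      (simp add: fun_eq_iff inner_diff_right algebra_simps)
  then have "((\<lambda>X. 1 / real (card I) * (\<Sum>l\<in>I. (A l \<bullet> Xs - A l \<bullet> X)\<^sup>2)) has_derivative
      (\<lambda>h. 1 / real (card I) * (\<Sum>l\<in>I. 2 * (A l \<bullet> (X - Xs)) * (A l \<bullet> h)))) (at X)"
    by (intro has_derivative_mult_right has_derivative_sum)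
  moreover have "1 / real (card I) * (\<Sum>l\<in>I. 2 * (A l \<bullet> (X - Xs)) * (A l \<bullet> h))
      = h \<bullet> (2 *\<^sub>R batch_gram A I (X - Xs))" for h
    by (simp add: inner_commute[of h] batch_gram_inner sum_distrib_left mult.assoc mult.left_commute)
  ultimately show "GDERIV (batch_cost A (sensing_map A Xs) I) X :> 2 *\<^sub>R batch_gram A I (X - Xs)"
    by (simp add: gderiv_def batch_cost_def[abs_def] sensing_map_def)
qed

lemma full_cost_eq_batch_cost: "full_cost A y = batch_cost A y UNIV"
  by (simp add: fun_eq_iff full_cost_def batch_cost_def sensing_map_def power2_norm_vec)

section \<open>Averages over all batches\<close>

text \<open>The expectation under \<open>pmf_of_set (batches b)\<close>, kept as a finite sum until
  the laws of the iterates enter.\<close>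

definition batch_mean :: "nat \<Rightarrow> ('m::finite set \<Rightarrow> real) \<Rightarrow> real" where
  "batch_mean b f = (\<Sum>I\<in>batches b. f I) / real (card (batches b :: 'm set set))"

context
  fixes b :: nat
  assumes b_ge: "1 \<le> b" and b_le: "b \<le> CARD('m::finite)"
begin

lemma batches_nonempty: "batches b \<noteq> ({} :: 'm set set)"
proof -
  obtain I :: "'m set" where "card I = b"
    using b_le obtain_subset_with_card_n by metis
  then show ?thesis
    by (auto simp: batches_def)
qed

lemma card_batches_pos: "0 < card (batches b :: 'm set set)"
  by (simp add: card_gt_0_iff batches_nonempty)

lemma batch_mean_mono:
  assumes "\<And>I. I \<in> batches b \<Longrightarrow> f I \<le> g I"
  shows "batch_mean b f \<le> batch_mean b (g :: 'm set \<Rightarrow> real)"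
  unfolding batch_mean_def by (intro divide_right_mono sum_mono assms) auto

lemma batch_mean_const [simp]: "batch_mean b (\<lambda>_ :: 'm set. c) = c"
  using batches_nonempty by (simp add: batch_mean_def)

lemma batch_mean_add:
  "batch_mean b (\<lambda>I. f I + g I) = batch_mean b f + batch_mean b (g :: 'm set \<Rightarrow> real)"
  by (simp add: batch_mean_def sum.distrib add_divide_distrib)

lemma batch_mean_cmult:
  "batch_mean b (\<lambda>I. c * f I) = c * batch_mean b (f :: 'm set \<Rightarrow> real)"
  by (simp add: batch_mean_def sum_distrib_left)

text \<open>Jensen's inequality for the square, as Cauchy-Schwarz against the constant function
  1.\<close>

lemma batch_mean_power2_le:
  "(batch_mean b f)\<^sup>2 \<le> batch_mean b (\<lambda>I. (f I)\<^sup>2 :: real)" for f :: "'m set \<Rightarrow> real"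
proof -
  have "(\<Sum>I\<in>batches b. f I * 1)\<^sup>2 \<le> (\<Sum>I\<in>batches b. (f I)\<^sup>2) * (\<Sum>I\<in>(batches b :: 'm set set). 1\<^sup>2)"
    by (rule Cauchy_Schwarz_ineq_sum)
  then show ?thesis
    using card_batches_pos
    by (simp add: batch_mean_def power_divide divide_simps power2_eq_square mult.assoc)
qed

lemma card_batches_containing:
  "card {I \<in> batches b. (l::'m) \<in> I} = (CARD('m) - 1) choose (b - 1)"
proof -
  have "{I \<in> batches b. l \<in> I} = insert l ` {J. J \<subseteq> - {l} \<and> card J = b - 1}"
  proof (intro equalityI subsetI)
    fix I assume "I \<in> {I \<in> batches b. l \<in> I}"
    then have "I = insert l (I - {l})" "I - {l} \<subseteq> - {l}" "card (I - {l}) = b - 1"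
      by (auto simp: batches_def)
    then show "I \<in> insert l ` {J. J \<subseteq> - {l} \<and> card J = b - 1}" by blast
  next
    fix I assume "I \<in> insert l ` {J. J \<subseteq> - {l} \<and> card J = b - 1}"
    then obtain J where "I = insert l J" "l \<notin> J" "card J = b - 1" by auto
    then show "I \<in> {I \<in> batches b. l \<in> I}"
      using b_ge by (simp add: batches_def)
  qed
  moreover have "inj_on (insert l) {J. J \<subseteq> - {l} \<and> card J = b - 1}"
    by (auto simp: inj_on_def)
  moreover have "card (- {l}) = CARD('m) - 1"
    by (simp add: Compl_eq_Diff_UNIV)
  ultimately show ?thesis
    using n_subsets[of "- {l}" "b - 1"] by (simp add: card_image)
qed

text \<open>By symmetry each index lies in the same number \<open>N\<close> of batches, so double
  counting turns the mean of batch averages into the full average.\<close>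

lemma batch_mean_average:
  fixes c :: "'m \<Rightarrow> real"
  shows "batch_mean b (\<lambda>I. 1 / real (card I) * (\<Sum>l\<in>I. c l)) = 1 / real CARD('m) * (\<Sum>l\<in>UNIV. c l)"
proof -
  define N where "N = real ((CARD('m) - 1) choose (b - 1))"
  have double_count: "(\<Sum>I\<in>batches b. \<Sum>l\<in>I. g l) = N * (\<Sum>l\<in>UNIV. g l)" for g :: "'m \<Rightarrow> real"
  proof -
    have "(\<Sum>I\<in>batches b. \<Sum>l\<in>I. g l) = (\<Sum>I\<in>batches b. \<Sum>l\<in>{l \<in> UNIV. l \<in> I}. g l)"
      by simp
    also have "\<dots> = (\<Sum>l\<in>UNIV. \<Sum>I\<in>{I \<in> batches b. l \<in> I}. g l)"
      by (rule sum.swap_restrict) auto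
    also have "\<dots> = N * (\<Sum>l\<in>UNIV. g l)"
      by (simp add: card_batches_containing N_def sum_distrib_left)
    finally show ?thesis .
  qed
  \<comment> \<open>Constant weight 1 in the same count gives the normalisation.\<close>
  have card_eq: "real (card (batches b :: 'm set set)) * real b = N * real CARD('m)"
    using double_count[of "\<lambda>_. 1"] by (simp add: batches_def)
  then have "N \<noteq> 0"
    using card_batches_pos b_ge by auto
  have "batch_mean b (\<lambda>I. 1 / real (card I) * (\<Sum>l\<in>I. c l))
      = (\<Sum>I\<in>batches b. 1 / real b * (\<Sum>l\<in>I. c l)) / real (card (batches b :: 'm set set))"
    unfolding batch_mean_def by (intro arg_cong2[of _ _ _ _ "(/)"] sum.cong) (auto simp: batches_def)
  also have "\<dots> = N * (\<Sum>l\<in>UNIV. c l) / (real (card (batches b :: 'm set set)) * real b)"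
    by (simp add: double_count sum_distrib_left[symmetric] sum_divide_distrib[symmetric] mult.commute)
  also have "\<dots> = 1 / real CARD('m) * (\<Sum>l\<in>UNIV. c l)"
    unfolding card_eq using \<open>N \<noteq> 0\<close> by simp
  finally show ?thesis .
qed

text \<open>Unbiasedness of the batch gradient.\<close>

lemma batch_mean_gram_inner:
  "batch_mean b (\<lambda>I. batch_gram A I X \<bullet> Y) = batch_gram (A :: 'm \<Rightarrow> real^'n2^'n1) UNIV X \<bullet> Y"
  unfolding batch_gram_inner by (rule batch_mean_average)

section \<open>The restricted isometry constant is attained\<close>

text \<open>On a nonzero matrix of rank at most \<open>s\<close>, the full energy is the mean of the
  batch energies, which forces \<open>1 - \<delta>\<close> to be at most
  \<open>1 + \<delta>\<close>.\<close>

lemma rip_bound_ge_0: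
  fixes A :: "'m \<Rightarrow> real^'n2^'n1"
  assumes "1 \<le> s" and rip: "rip_bound A b s \<delta>"
  shows "0 \<le> \<delta>"
proof -
  \<comment> \<open>The all-ones matrix is a nonzero witness of rank at most 1, since all its rows
    coincide.\<close>
  define X :: "real^'n2^'n1" where "X = (\<chi> i j. 1)"
  have "rows X \<subseteq> {1}"
    by (auto simp: X_def rows_def row_def vec_eq_iff)
  then have "dim (rows X) \<le> dim {1 :: real^'n2}"
    by (rule dim_subset)
  also have "\<dots> \<le> 1"
    using dim_le_card'[of "{1 :: real^'n2}"] by simp
  finally have "dim (rows X) \<le> 1" .
  then have "rank X \<le> s"
    using \<open>1 \<le> s\<close> by (simp add: row_rank_def)
  have "X \<noteq> 0"
    by (simp add: X_def vec_eq_iff)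
  have "(1 - \<delta>) * (norm X)\<^sup>2 \<le> batch_gram A UNIV X \<bullet> X"
    using rip \<open>rank X \<le> s\<close> unfolding rip_bound_def norm_sensing_map_eq by blast
  also have "\<dots> = batch_mean b (\<lambda>I. batch_gram A I X \<bullet> X)"
    by (rule batch_mean_gram_inner[symmetric])
  also have "\<dots> \<le> batch_mean b (\<lambda>_ :: 'm set. (1 + \<delta>) * (norm X)\<^sup>2)"
    using rip \<open>rank X \<le> s\<close> unfolding rip_bound_def batch_gram_inner_self
    by (intro batch_mean_mono) blast
  finally show ?thesis
    using \<open>X \<noteq> 0\<close> by simp
qed

text \<open>For \<open>\<delta> = 1 + C\<close> the lower bound has a nonpositive left side, and the
  upper bound follows from Cauchy-Schwarz for each measurement.\<close>

lemma rip_bound_exists: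
  fixes A :: "'m \<Rightarrow> real^'n2^'n1"
  shows "\<exists>\<delta>. rip_bound A b s \<delta>"
proof -
  define C where "C = (\<Sum>l\<in>UNIV. (norm (A l))\<^sup>2)"
  have "C \<ge> 0" by (simp add: C_def sum_nonneg)
  have "(1 - (1 + C)) * (norm X)\<^sup>2 \<le> 1 / real CARD('m) * (norm (sensing_map A X))\<^sup>2" for X
  proof -
    have "(1 - (1 + C)) * (norm X)\<^sup>2 \<le> 0"
      using \<open>C \<ge> 0\<close> by simp
    also have "0 \<le> 1 / real CARD('m) * (norm (sensing_map A X))\<^sup>2"
      by simp
    finally show ?thesis .
  qed
  moreover have "1 / real (card I) * (\<Sum>l\<in>I. (A l \<bullet> X)\<^sup>2) \<le> (1 + (1 + C)) * (norm X)\<^sup>2"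
    if "I \<in> batches b" for I X
  proof -
    have "(A l \<bullet> X)\<^sup>2 \<le> (norm (A l))\<^sup>2 * (norm X)\<^sup>2" for l
      using power_mono[OF Cauchy_Schwarz_ineq2[of "A l" X], of 2] by (simp add: power_mult_distrib)
    then have "(\<Sum>l\<in>I. (A l \<bullet> X)\<^sup>2) \<le> (\<Sum>l\<in>I. (norm (A l))\<^sup>2 * (norm X)\<^sup>2)"
      by (rule sum_mono)
    also have "\<dots> \<le> (\<Sum>l\<in>UNIV. (norm (A l))\<^sup>2 * (norm X)\<^sup>2)"
      by (rule sum_mono2) auto
    also have "\<dots> = C * (norm X)\<^sup>2"
      by (simp add: C_def sum_distrib_right)
    finally have "(\<Sum>l\<in>I. (A l \<bullet> X)\<^sup>2) \<le> C * (norm X)\<^sup>2" .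
    moreover have "1 / real (card I) \<le> 1"
      using that b_ge by (simp add: batches_def)
    ultimately have "1 / real (card I) * (\<Sum>l\<in>I. (A l \<bullet> X)\<^sup>2) \<le> 1 * (C * (norm X)\<^sup>2)"
      using \<open>C \<ge> 0\<close> by (intro mult_mono) (auto intro: sum_nonneg)
    also have "\<dots> \<le> (1 + (1 + C)) * (norm X)\<^sup>2"
      by (simp add: distrib_right)
    finally show ?thesis .
  qed
  ultimately have "rip_bound A b s (1 + C)"
    by (simp add: rip_bound_def)
  then show ?thesis ..
qed

lemma closed_rip_bound: "closed {\<delta>. rip_bound (A :: 'm \<Rightarrow> real^'n2^'n1) b s \<delta>}"
proof -
  have "{\<delta>. rip_bound A b s \<delta>} = (\<Inter>X\<in>{X. rank X \<le> s}.
      {\<delta>. (1 - \<delta>) * (norm X)\<^sup>2 \<le> 1 / real CARD('m) * (norm (sensing_map A X))\<^sup>2} \<inter>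
      (\<Inter>I\<in>batches b. {\<delta>. 1 / real (card I) * (\<Sum>l\<in>I. (A l \<bullet> X)\<^sup>2) \<le> (1 + \<delta>) * (norm X)\<^sup>2}))"
    unfolding rip_bound_def by blast
  moreover have "closed \<dots>"
    by (intro closed_INT closed_Int ballI closed_Collect_le continuous_intros)
  ultimately show ?thesis by simp
qed

text \<open>The admissible constants form a nonempty closed set bounded below, so the
  \<open>LEAST\<close> in \<open>ric\<close> is a genuine minimum, equal to the infimum.\<close>

lemma rip_bound_ric:
  fixes A :: "'m \<Rightarrow> real^'n2^'n1"
  assumes "1 \<le> s"
  shows "rip_bound A b s (ric A b s)"
proof -
  let ?S = "{\<delta>. rip_bound A b s \<delta>}"
  have bdd: "bdd_below ?S"
    using rip_bound_ge_0[OF assms] by (auto simp: bdd_below_def)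
  have "Inf ?S \<in> ?S"
    using rip_bound_exists bdd closed_rip_bound by (intro closed_contains_Inf) auto
  moreover have "ric A b s = Inf ?S"
    unfolding ric_def using calculation bdd
    by (intro Least_equality) (auto intro: cInf_lower)
  ultimately show ?thesis by simp
qed

end

section \<open>One gradient step and one thresholding\<close>

text \<open>
  Compressing the Gram operator to the span of \<open>D\<close> and \<open>Z\<close> bounds its norm by \<open>\<beta>\<close>, so only
  matrices of that span have to satisfy the upper isometry bound.
\<close>

lemma inner_gradient_step_le:
  fixes A :: "'m::finite \<Rightarrow> real^'n2^'n1"
  assumes up: "\<And>W. W \<in> span {D, Z} \<Longrightarrow> batch_gram A I W \<bullet> W \<le> \<beta> * (norm W)\<^sup>2"
  shows "D \<bullet> (Z - (2 * \<eta>) *\<^sub>R batch_gram A I Z)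
    \<le> norm D * sqrt ((norm Z)\<^sup>2 - 4 * (\<eta> - \<eta>\<^sup>2 * \<beta>) * (batch_gram A I Z \<bullet> Z))"
proof -
  \<comment> \<open>\<open>P\<close> is the orthogonal projection of the gradient direction onto the
    span; \<open>R\<close> is invisible to \<open>D\<close> and \<open>Z\<close>.\<close>
  obtain P R where P: "P \<in> span {D, Z}" and R: "\<And>w. w \<in> span {D, Z} \<Longrightarrow> orthogonal R w"
    and PR: "batch_gram A I Z = P + R"
    using orthogonal_subspace_decomp_exists[of "{D, Z}" "batch_gram A I Z"] by metis
  have proj: "batch_gram A I Z \<bullet> w = P \<bullet> w" if "w \<in> span {D, Z}" for w
    using R[OF that] by (simp add: PR inner_add_left orthogonal_def)
  have memD: "D \<in> span {D, Z}" and memZ: "Z \<in> span {D, Z}"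
    by (auto intro: span_base)
  \<comment> \<open>Testing the Gram form against \<open>P\<close> itself gives the squared norm of
    \<open>P\<close>; Cauchy-Schwarz and the upper bound on \<open>P\<close> then leave one factor
    to cancel.\<close>
  have "((norm P)\<^sup>2)\<^sup>2 \<le> (batch_gram A I Z \<bullet> Z) * (batch_gram A I P \<bullet> P)"
    using batch_gram_cauchy_schwarz[of A I Z P] by (simp add: proj[OF P] power2_norm_eq_inner)
  also have "\<dots> \<le> (batch_gram A I Z \<bullet> Z) * (\<beta> * (norm P)\<^sup>2)"
    by (intro mult_left_mono up[OF P] batch_gram_nonneg)
  finally have "(norm P)\<^sup>2 * (norm P)\<^sup>2 \<le> (\<beta> * (batch_gram A I Z \<bullet> Z)) * (norm P)\<^sup>2"
    by (simp add: power2_eq_square mult_ac)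
  then have normP: "(norm P)\<^sup>2 \<le> \<beta> * (batch_gram A I Z \<bullet> Z)" if "P \<noteq> 0"
    using that by (intro mult_right_le_imp_le[of "(norm P)\<^sup>2" "(norm P)\<^sup>2"]) auto
  have "0 \<le> \<beta> * (batch_gram A I Z \<bullet> Z)"
  proof (cases "Z = 0")
    case False
    have "0 \<le> \<beta> * (norm Z)\<^sup>2"
      using batch_gram_nonneg[of A I Z] up[OF memZ] by linarith
    with False have "0 \<le> \<beta>"
      by (simp add: zero_le_mult_iff)
    then show ?thesis
      by (simp add: batch_gram_nonneg)
  qed simp
  with normP have normP: "(norm P)\<^sup>2 \<le> \<beta> * (batch_gram A I Z \<bullet> Z)"
    by (cases "P = 0") auto
  have "(norm (Z - (2 * \<eta>) *\<^sub>R P))\<^sup>2 = (norm Z)\<^sup>2 - 4 * \<eta> * (P \<bullet> Z) + 4 * \<eta>\<^sup>2 * (norm P)\<^sup>2"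
    unfolding power2_norm_eq_inner
    by (simp add: inner_diff_left inner_diff_right inner_commute power2_eq_square algebra_simps)
  also have "\<dots> \<le> (norm Z)\<^sup>2 - 4 * \<eta> * (P \<bullet> Z) + 4 * \<eta>\<^sup>2 * (\<beta> * (batch_gram A I Z \<bullet> Z))"
    using normP by (intro add_left_mono mult_left_mono) auto
  also have "\<dots> = (norm Z)\<^sup>2 - 4 * (\<eta> - \<eta>\<^sup>2 * \<beta>) * (batch_gram A I Z \<bullet> Z)"
    by (simp add: proj[OF memZ] algebra_simps)
  finally have "norm (Z - (2 * \<eta>) *\<^sub>R P)
      \<le> sqrt ((norm Z)\<^sup>2 - 4 * (\<eta> - \<eta>\<^sup>2 * \<beta>) * (batch_gram A I Z \<bullet> Z))"
    by (rule real_le_rsqrt)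
  moreover have "D \<bullet> (Z - (2 * \<eta>) *\<^sub>R batch_gram A I Z) = D \<bullet> (Z - (2 * \<eta>) *\<^sub>R P)"
    using proj[OF memD] by (simp add: inner_diff_right inner_commute)
  ultimately show ?thesis
    using norm_cauchy_schwarz[of D "Z - (2 * \<eta>) *\<^sub>R P"]
    by (smt (verit) mult_left_mono norm_ge_zero)
qed

text \<open>\<open>Xs\<close> competes in the minimisation that defines \<open>Z\<close>. Expanding
  both squares around \<open>Xs\<close> cancels the squared norm of \<open>W - Xs\<close>.\<close>

lemma best_rank_approx_norm_diff_le:
  assumes "best_rank_approx r W Z" and "rank Xs \<le> r"
  shows "(norm (Z - Xs))\<^sup>2 \<le> 2 * ((Z - Xs) \<bullet> (W - Xs))"
proof -
  have "norm (W - Z) \<le> norm (W - Xs)"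
    using assms by (force simp: best_rank_approx_def is_arg_min_def)
  then have "(norm (W - Z))\<^sup>2 \<le> (norm (W - Xs))\<^sup>2"
    by (rule power_mono) simp
  then show ?thesis
    by (simp add: power2_norm_eq_inner inner_diff_left inner_diff_right inner_commute)
qed

text \<open>Tower property with a conditional bound; finite supports turn the expectations into
  finite sums.\<close>

lemma expectation_bind_le:
  fixes f :: "'a \<Rightarrow> 'b pmf" and h :: "'b \<Rightarrow> real"
  assumes "finite (set_pmf p)" "\<And>x. x \<in> set_pmf p \<Longrightarrow> finite (set_pmf (f x))"
    and "\<And>x. x \<in> set_pmf p \<Longrightarrow> measure_pmf.expectation (f x) h \<le> g x"
  shows "measure_pmf.expectation (bind_pmf p f) h \<le> measure_pmf.expectation p g"
proof -
  have "measure_pmf.expectation (bind_pmf p f) h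
      = (\<Sum>x\<in>set_pmf p. pmf p x *\<^sub>R measure_pmf.expectation (f x) h)"
    using assms(1,2) by (intro pmf_expectation_bind) auto
  also have "\<dots> \<le> (\<Sum>x\<in>set_pmf p. pmf p x *\<^sub>R g x)"
    using assms(3) by (intro sum_mono scaleR_left_mono) auto
  also have "\<dots> = measure_pmf.expectation p g"
    using assms(1) by (intro integral_measure_pmf[symmetric]) auto
  finally show ?thesis .
qed

section \<open>Contraction of the error in one step\<close>

text \<open>The step size enters only through the square of \<open>\<rho>\<close> and the sign of
  \<open>\<eta> - \<eta>\<^sup>2 * (1 + \<delta>)\<close>; the interval for \<open>\<eta>\<close> is
  translated into these in the final theorem.\<close>

locale svrg_rip =
  fixes A :: "'m::finite \<Rightarrow> real^'n2^'n1"
    and Xs :: "real^'n2^'n1"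
    and H :: "real^'n2^'n1 \<Rightarrow> real^'n2^'n1"
    and r b :: nat
    and \<eta> \<delta> \<rho> :: real
  assumes b_ge: "1 \<le> b" and b_le: "b \<le> CARD('m)"
    and rank_Xs: "rank Xs \<le> r"
    and H: "\<And>W. best_rank_approx r W (H W)"
    and rip: "rip_bound A b (3 * r) \<delta>"
    and \<rho>_nonneg: "0 \<le> \<rho>"
    and \<rho>_power2: "\<rho>\<^sup>2 = 4 * (1 - 4 * (1 - \<delta>) * (\<eta> - \<eta>\<^sup>2 * (1 + \<delta>)))"
    and step_nonneg: "0 \<le> \<eta> - \<eta>\<^sup>2 * (1 + \<delta>)"
begin

lemma rip_lower: "rank X \<le> 3 * r \<Longrightarrow> (1 - \<delta>) * (norm X)\<^sup>2 \<le> batch_gram A UNIV X \<bullet> X"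
  using rip unfolding rip_bound_def norm_sensing_map_eq by blast

lemma rip_upper:
  "rank X \<le> 3 * r \<Longrightarrow> I \<in> batches b \<Longrightarrow> batch_gram A I X \<bullet> X \<le> (1 + \<delta>) * (norm X)\<^sup>2"
  using rip unfolding rip_bound_def batch_gram_inner_self by blast

definition contraction :: "'m set \<Rightarrow> real^'n2^'n1 \<Rightarrow> real" where
  "contraction I Z = sqrt ((norm Z)\<^sup>2 - 4 * (\<eta> - \<eta>\<^sup>2 * (1 + \<delta>)) * (batch_gram A I Z \<bullet> Z))"

lemma rank_H: "rank (H W) \<le> r"
  using H[of W] by (simp add: best_rank_approx_def is_arg_min_def)

lemma rank_diff_Xs: "rank X \<le> r \<Longrightarrow> rank (X - Xs) \<le> 3 * r"
  by (rule rank_span_differences_le[of X r X Xs]) (use rank_Xs in \<open>auto intro: span_base\<close>)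

text \<open>The content is that the radicand is nonnegative: by the upper isometry bound it
  dominates a square times the squared norm of \<open>Z\<close>.\<close>

lemma contraction_power2:
  assumes "rank Z \<le> 3 * r" "I \<in> batches b"
  shows "(contraction I Z)\<^sup>2
    = (norm Z)\<^sup>2 - 4 * (\<eta> - \<eta>\<^sup>2 * (1 + \<delta>)) * (batch_gram A I Z \<bullet> Z)"
proof -
  have "0 \<le> (1 - 2 * \<eta> * (1 + \<delta>))\<^sup>2 * (norm Z)\<^sup>2"
    by simp
  also have "\<dots> = (norm Z)\<^sup>2 - 4 * (\<eta> - \<eta>\<^sup>2 * (1 + \<delta>)) * ((1 + \<delta>) * (norm Z)\<^sup>2)"
    by (simp add: power2_eq_square algebra_simps)
  also have "\<dots> \<le> (norm Z)\<^sup>2 - 4 * (\<eta> - \<eta>\<^sup>2 * (1 + \<delta>)) * (batch_gram A I Z \<bullet> Z)"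
    using rip_upper[OF assms] step_nonneg by (intro diff_left_mono mult_left_mono) auto
  finally show ?thesis
    by (simp add: contraction_def)
qed

text \<open>Jensen passes to the squares, where the batch energies average to the full energy and
  the lower isometry bound applies.\<close>

lemma batch_mean_contraction_le:
  assumes "rank Z \<le> 3 * r"
  shows "batch_mean b (\<lambda>I. contraction I Z) \<le> \<rho> / 2 * norm Z"
proof (rule power2_le_imp_le)
  let ?c = "4 * (\<eta> - \<eta>\<^sup>2 * (1 + \<delta>))"
  have "(batch_mean b (\<lambda>I. contraction I Z))\<^sup>2 \<le> batch_mean b (\<lambda>I. (contraction I Z)\<^sup>2)"
    by (rule batch_mean_power2_le[OF b_ge b_le])
  also have "\<dots> \<le> batch_mean b (\<lambda>I. (norm Z)\<^sup>2 + (- ?c) * (batch_gram A I Z \<bullet> Z))"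
    by (intro batch_mean_mono[OF b_ge b_le]) (simp add: contraction_power2[OF assms] algebra_simps)
  also have "\<dots> = (norm Z)\<^sup>2 + (- ?c) * (batch_gram A UNIV Z \<bullet> Z)"
    unfolding batch_mean_add[OF b_ge b_le] batch_mean_cmult[OF b_ge b_le]
      batch_mean_const[OF b_ge b_le] batch_mean_gram_inner[OF b_ge b_le] ..
  also have "\<dots> \<le> (norm Z)\<^sup>2 + (- ?c) * ((1 - \<delta>) * (norm Z)\<^sup>2)"
    using rip_lower[OF assms] step_nonneg by (intro add_left_mono mult_left_mono_neg) auto
  also have "\<dots> = (\<rho> / 2 * norm Z)\<^sup>2"
    by (simp add: power_mult_distrib power_divide \<rho>_power2 algebra_simps)
  finally show "(batch_mean b (\<lambda>I. contraction I Z))\<^sup>2 \<le> (\<rho> / 2 * norm Z)\<^sup>2" .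
qed (simp add: \<rho>_nonneg)

text \<open>Both signs of \<open>D\<close> are covered because the batch step on the outer error is
  subtracted; the sign changes neither the span nor the norm.\<close>

lemma inner_gradient_step_le_contraction:
  assumes "rank U \<le> r" "rank V \<le> r" "I \<in> batches b" "D \<in> {U - Xs, Xs - U}"
  shows "D \<bullet> ((V - Xs) - (2 * \<eta>) *\<^sub>R batch_gram A I (V - Xs))
    \<le> norm (U - Xs) * contraction I (V - Xs)"
proof -
  have "D \<in> span {U - Xs, V - Xs}"
    using assms(4) span_neg[of "U - Xs" "{U - Xs, V - Xs}"] by (auto intro: span_base)
  then have "span {D, V - Xs} \<subseteq> span {U - Xs, V - Xs}"
    by (intro span_minimal) (auto intro: span_base)
  then have "batch_gram A I W \<bullet> W \<le> (1 + \<delta>) * (norm W)\<^sup>2" if "W \<in> span {D, V - Xs}" for W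
    using that rank_span_differences_le[OF assms(1,2) rank_Xs] rip_upper[OF _ assms(3)] by blast
  then have "D \<bullet> ((V - Xs) - (2 * \<eta>) *\<^sub>R batch_gram A I (V - Xs)) \<le> norm D * contraction I (V - Xs)"
    unfolding contraction_def by (rule inner_gradient_step_le)
  moreover have "norm D = norm (U - Xs)"
    using assms(4) by (auto simp: norm_minus_commute)
  ultimately show ?thesis by simp
qed

text \<open>
  The matrices \<open>U\<close>, \<open>X\<close>, \<open>Xt\<close> and \<open>Xs\<close>, with \<open>U\<close> the new iterate, can span rank \<open>4 * r\<close>.
  Pairing \<open>U - Xs\<close> separately with the terms in \<open>X - Xs\<close> and in \<open>Xt - Xs\<close> keeps the rank at
  most \<open>3 * r\<close>. The full gradient is the average of the batch gradients, which yields the mean over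
  \<open>J\<close> and avoids any upper isometry bound for the full map.
\<close>

lemma norm_svrg_step_le:
  assumes X: "rank X \<le> r" and Xt: "rank Xt \<le> r" and I: "I \<in> batches b"
  shows "norm (svrg_step H A (sensing_map A Xs) \<eta> Xt I X - Xs)
    \<le> 2 * (contraction I (X - Xs) + (contraction I (Xt - Xs)
            + batch_mean b (\<lambda>J. contraction J (Xt - Xs))))"
proof -
  define S where "S I Z = Z - (2 * \<eta>) *\<^sub>R batch_gram A I Z" for I Z
  define W where "W = X - \<eta> *\<^sub>R (grad (batch_cost A (sensing_map A Xs) I) X
    - grad (batch_cost A (sensing_map A Xs) I) Xt + grad (full_cost A (sensing_map A Xs)) Xt)"
  define D where "D = H W - Xs"
  have "W - Xs = S I (X - Xs) - S I (Xt - Xs) + S UNIV (Xt - Xs)"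
    by (simp add: W_def S_def full_cost_eq_batch_cost grad_batch_cost algebra_simps)
  then have "(norm D)\<^sup>2 \<le> 2 * (D \<bullet> S I (X - Xs) + (- D) \<bullet> S I (Xt - Xs) + D \<bullet> S UNIV (Xt - Xs))"
    using best_rank_approx_norm_diff_le[OF H[of W] rank_Xs]
    by (simp add: D_def[symmetric] inner_add_right inner_diff_right)
  also have "\<dots> \<le> 2 * (norm D * contraction I (X - Xs) + norm D * contraction I (Xt - Xs)
      + norm D * batch_mean b (\<lambda>J. contraction J (Xt - Xs)))"
  proof (intro mult_left_mono add_mono)
    show "D \<bullet> S I (X - Xs) \<le> norm D * contraction I (X - Xs)"
      using inner_gradient_step_le_contraction[OF rank_H X I] by (simp add: D_def S_def)
    show "(- D) \<bullet> S I (Xt - Xs) \<le> norm D * contraction I (Xt - Xs)"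
      using inner_gradient_step_le_contraction[OF rank_H Xt I, of "- D" W] by (simp add: D_def S_def)
    have "D \<bullet> S UNIV (Xt - Xs)
        = batch_mean b (\<lambda>J. D \<bullet> (Xt - Xs) + (- 2 * \<eta>) * (batch_gram A J (Xt - Xs) \<bullet> D))"
      unfolding batch_mean_add[OF b_ge b_le] batch_mean_cmult[OF b_ge b_le]
        batch_mean_const[OF b_ge b_le] batch_mean_gram_inner[OF b_ge b_le]
      by (simp add: S_def inner_diff_right inner_commute)
    also have "\<dots> \<le> batch_mean b (\<lambda>J. norm D * contraction J (Xt - Xs))"
    proof (intro batch_mean_mono[OF b_ge b_le])
      fix J :: "'m set" assume "J \<in> batches b"
      from inner_gradient_step_le_contraction[OF rank_H Xt this, of D W]
      show "D \<bullet> (Xt - Xs) + (- 2 * \<eta>) * (batch_gram A J (Xt - Xs) \<bullet> D)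
          \<le> norm D * contraction J (Xt - Xs)"
        by (simp add: D_def inner_diff_right inner_commute)
    qed
    finally show "D \<bullet> S UNIV (Xt - Xs) \<le> norm D * batch_mean b (\<lambda>J. contraction J (Xt - Xs))"
      unfolding batch_mean_cmult[OF b_ge b_le] .
  qed simp
  finally have "norm D * norm D \<le> norm D * (2 * (contraction I (X - Xs) + (contraction I (Xt - Xs)
            + batch_mean b (\<lambda>J. contraction J (Xt - Xs)))))"
    by (simp add: power2_eq_square algebra_simps)
  moreover have "0 \<le> contraction J (V - Xs)" if "rank V \<le> r" "J \<in> batches b" for J V
    using contraction_power2[OF rank_diff_Xs[OF that(1)] that(2)]
    unfolding contraction_def by (metis real_sqrt_ge_zero zero_le_power2)
  then have "0 \<le> 2 * (contraction I (X - Xs) + (contraction I (Xt - Xs)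
            + batch_mean b (\<lambda>J. contraction J (Xt - Xs))))"
    using X Xt I batch_mean_mono[OF b_ge b_le, of "\<lambda>_. 0" "\<lambda>J. contraction J (Xt - Xs)"]
      batch_mean_const[OF b_ge b_le, of 0] by simp
  \<comment> \<open>One factor \<open>norm D\<close> cancels; for \<open>D = 0\<close> the claim is
    the nonnegativity just shown.\<close>
  ultimately have "norm D \<le> 2 * (contraction I (X - Xs) + (contraction I (Xt - Xs)
            + batch_mean b (\<lambda>J. contraction J (Xt - Xs))))"
    by (cases "D = 0") (auto simp: mult_le_cancel_left)
  then show ?thesis
    by (simp add: svrg_step_def D_def W_def)
qed

text \<open>The mean over \<open>J\<close> is constant in \<open>I\<close>, so the outer error is
  counted twice and the current error once.\<close>

lemma batch_mean_svrg_step_le: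
  assumes X: "rank X \<le> r" and Xt: "rank Xt \<le> r"
  shows "batch_mean b (\<lambda>I. norm (svrg_step H A (sensing_map A Xs) \<eta> Xt I X - Xs))
    \<le> \<rho> * norm (X - Xs) + 2 * \<rho> * norm (Xt - Xs)"
proof -
  have "batch_mean b (\<lambda>I. norm (svrg_step H A (sensing_map A Xs) \<eta> Xt I X - Xs))
    \<le> batch_mean b (\<lambda>I. 2 * (contraction I (X - Xs) + (contraction I (Xt - Xs)
            + batch_mean b (\<lambda>J. contraction J (Xt - Xs)))))"
    by (intro batch_mean_mono[OF b_ge b_le] norm_svrg_step_le[OF X Xt])
  also have "\<dots> = 2 * (batch_mean b (\<lambda>I. contraction I (X - Xs))
      + (batch_mean b (\<lambda>J. contraction J (Xt - Xs)) + batch_mean b (\<lambda>J. contraction J (Xt - Xs))))"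
    unfolding batch_mean_cmult[OF b_ge b_le] batch_mean_add[OF b_ge b_le]
      batch_mean_const[OF b_ge b_le] ..
  also have "\<dots> \<le> \<rho> * norm (X - Xs) + 2 * \<rho> * norm (Xt - Xs)"
    using batch_mean_contraction_le[OF rank_diff_Xs[OF X]]
      batch_mean_contraction_le[OF rank_diff_Xs[OF Xt]] by (simp add: field_simps)
  finally show ?thesis .
qed

section \<open>Expected errors of the inner and outer iterates\<close>

lemma finite_svrg_inner: "finite (set_pmf (svrg_inner H A y b \<eta> Xt t))"
  by (induction t) auto

lemma rank_svrg_inner:
  assumes "rank Xt \<le> r" "X \<in> set_pmf (svrg_inner H A y b \<eta> Xt t)"
  shows "rank X \<le> r"
  using assms by (cases t) (auto simp: svrg_step_def rank_H)

lemma finite_svrg_arm: "finite (set_pmf (svrg_arm H A y b \<eta> n X0 k))"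
  by (induction k) (auto simp: finite_svrg_inner)

lemma rank_svrg_arm:
  assumes "rank X0 \<le> r" "X \<in> set_pmf (svrg_arm H A y b \<eta> n X0 k)"
  shows "rank X \<le> r"
  using assms(2) by (induction k arbitrary: X) (auto simp: assms(1) dest: rank_svrg_inner)

text \<open>Unrolling the one-step recursion from the start \<open>Xt\<close>: the outer error
  re-enters at every step and builds the geometric sum.\<close>

lemma expectation_svrg_inner_le:
  assumes Xt: "rank Xt \<le> r"
  shows "measure_pmf.expectation (svrg_inner H A (sensing_map A Xs) b \<eta> Xt t) (\<lambda>X. norm (X - Xs))
    \<le> (\<rho> ^ t + 2 * \<rho> * (\<Sum>i<t. \<rho> ^ i)) * norm (Xt - Xs)"
proof (induction t)
  case (Suc t)
  let ?y = "sensing_map A Xs"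
  let ?p = "svrg_inner H A ?y b \<eta> Xt t"
  have "measure_pmf.expectation (svrg_inner H A ?y b \<eta> Xt (Suc t)) (\<lambda>X. norm (X - Xs))
      \<le> measure_pmf.expectation ?p (\<lambda>X. \<rho> * norm (X - Xs) + 2 * \<rho> * norm (Xt - Xs))"
    unfolding svrg_inner.simps
  proof (rule expectation_bind_le)
    fix X assume "X \<in> set_pmf ?p"
    with Xt have "rank X \<le> r" by (rule rank_svrg_inner)
    then show "measure_pmf.expectation (map_pmf (\<lambda>I. svrg_step H A ?y \<eta> Xt I X) (pmf_of_set (batches b)))
        (\<lambda>X. norm (X - Xs)) \<le> \<rho> * norm (X - Xs) + 2 * \<rho> * norm (Xt - Xs)"
      using batch_mean_svrg_step_le[OF _ Xt] batches_nonempty[OF b_ge b_le]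
      by (simp add: integral_pmf_of_set batch_mean_def)
  qed (auto simp: finite_svrg_inner)
  also have "\<dots> = \<rho> * measure_pmf.expectation ?p (\<lambda>X. norm (X - Xs)) + 2 * \<rho> * norm (Xt - Xs)"
    using finite_svrg_inner[of ?y Xt t]
    by (subst Bochner_Integration.integral_add) (auto intro: integrable_measure_pmf_finite)
  also have "\<dots> \<le> \<rho> * ((\<rho> ^ t + 2 * \<rho> * (\<Sum>i<t. \<rho> ^ i)) * norm (Xt - Xs)) + 2 * \<rho> * norm (Xt - Xs)"
    using Suc.IH \<rho>_nonneg by (intro add_right_mono mult_left_mono)
  also have "\<dots> = (\<rho> ^ Suc t + 2 * \<rho> * (1 + (\<Sum>i<t. \<rho> ^ Suc i))) * norm (Xt - Xs)"
    by (simp add: algebra_simps sum_distrib_left)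
  also have "1 + (\<Sum>i<t. \<rho> ^ Suc i) = (\<Sum>i<Suc t. \<rho> ^ i)"
    by (subst sum.lessThan_Suc_shift) simp
  finally show ?case .
qed simp

text \<open>Every outer iterate in the support has rank at most \<open>r\<close>, so the inner bound
  holds conditionally on it and contributes one factor \<open>\<kappa>\<close>.\<close>

lemma expectation_svrg_arm_le:
  assumes X0: "rank X0 \<le> r" and \<kappa>: "\<kappa> = \<rho> ^ n + 2 * \<rho> * (\<Sum>i<n. \<rho> ^ i)"
  shows "measure_pmf.expectation (svrg_arm H A (sensing_map A Xs) b \<eta> n X0 k) (\<lambda>X. norm (X - Xs))
    \<le> \<kappa> ^ k * norm (X0 - Xs)"
proof (induction k)
  case (Suc k)
  let ?p = "svrg_arm H A (sensing_map A Xs) b \<eta> n X0 k"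
  have "0 \<le> \<kappa>"
    using \<rho>_nonneg by (simp add: \<kappa> sum_nonneg)
  have "measure_pmf.expectation (svrg_arm H A (sensing_map A Xs) b \<eta> n X0 (Suc k)) (\<lambda>X. norm (X - Xs))
      \<le> measure_pmf.expectation ?p (\<lambda>X. \<kappa> * norm (X - Xs))"
    unfolding svrg_arm.simps \<kappa>
    by (intro expectation_bind_le expectation_svrg_inner_le finite_svrg_arm finite_svrg_inner)
      (rule rank_svrg_arm[OF X0])
  also have "\<dots> \<le> \<kappa> * (\<kappa> ^ k * norm (X0 - Xs))"
    using Suc.IH \<open>0 \<le> \<kappa>\<close> by (simp add: mult_left_mono)
  finally show ?case
    by (simp add: mult.assoc)
qed simp

end

section \<open>The step size condition and the convergence rate\<close>

theorem theorem3p1: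
  fixes A :: "'m::finite \<Rightarrow> real^'n2^'n1"
    and y :: "real^'m"
    and Xs X0 :: "real^'n2^'n1"
    and H :: "real^'n2^'n1 \<Rightarrow> real^'n2^'n1"
    and r b n :: nat
    and \<eta> \<delta> \<rho> \<kappa> :: real
  assumes "1 \<le> r" and "3 * r \<le> min CARD('n1) CARD('n2)"
    and "1 \<le> b" and "b \<le> CARD('m)"
    and "1 \<le> n"
    and "rank Xs \<le> r" and "y = sensing_map A Xs"
    and "is_arg_min (full_cost A y) (\<lambda>X. rank X \<le> r) Xs"
    and "\<And>W. best_rank_approx r W (H W)"
    and "rank X0 \<le> r"
    and "\<delta> = ric A b (3 * r)" and "\<delta> \<le> 1 / 71"
    and "(6 - 6 * \<delta> - sqrt (71 * \<delta>\<^sup>2 - 72 * \<delta> + 1)) / (12 - 12 * \<delta>\<^sup>2) < \<eta>"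
    and "\<eta> < (6 - 6 * \<delta> + sqrt (71 * \<delta>\<^sup>2 - 72 * \<delta> + 1)) / (12 - 12 * \<delta>\<^sup>2)"
    and "\<rho> = 2 * sqrt (1 - 2 * (1 - \<delta>) * (2 * \<eta> - 2 * \<eta>\<^sup>2 * (1 + \<delta>)))"
    and "\<kappa> = (- 3 * \<rho> ^ (n + 1) + \<rho> ^ n + 2 * \<rho>) / (1 - \<rho>)"
  shows "\<kappa> < 1 \<and>
    (\<forall>k. measure_pmf.expectation (svrg_arm H A y b \<eta> n X0 k) (\<lambda>X. norm (X - Xs))
           \<le> \<kappa> ^ k * norm (X0 - Xs))"
proof -
  have rip: "rip_bound A b (3 * r) \<delta>"
    unfolding assms(11) using assms(1,3,4) by (intro rip_bound_ric) auto
  then have \<delta>_ge: "0 \<le> \<delta>"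
    using assms(1,3,4) by (intro rip_bound_ge_0) auto
  define q where "q = \<eta> - \<eta>\<^sup>2 * (1 + \<delta>)"
  have \<rho>_eq: "\<rho> = 2 * sqrt (1 - 4 * (1 - \<delta>) * q)"
    by (simp add: assms(15) q_def algebra_simps)
  have "\<delta>\<^sup>2 < 1"
    using \<delta>_ge assms(12) by (simp add: power_less_one_iff)
  then have den: "0 < 12 - 12 * \<delta>\<^sup>2"
    by simp
  define s where "s = sqrt (71 * \<delta>\<^sup>2 - 72 * \<delta> + 1)"
  \<comment> \<open>This factorisation is where the threshold 1/71 makes the discriminant
    nonnegative.\<close>
  have "71 * \<delta>\<^sup>2 - 72 * \<delta> + 1 = (1 - 71 * \<delta>) * (1 - \<delta>)"
    by (simp add: power2_eq_square algebra_simps)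
  also have "\<dots> \<ge> 0"
    using assms(12) by (intro mult_nonneg_nonneg) auto
  finally have s2: "s\<^sup>2 = 71 * \<delta>\<^sup>2 - 72 * \<delta> + 1"
    by (simp add: s_def)
  have "6 - 6 * \<delta> - s < \<eta> * (12 - 12 * \<delta>\<^sup>2)" "\<eta> * (12 - 12 * \<delta>\<^sup>2) < 6 - 6 * \<delta> + s"
    using assms(13,14) den by (simp_all add: s_def pos_divide_less_eq pos_less_divide_eq)
  then have "\<bar>\<eta> * (12 - 12 * \<delta>\<^sup>2) - (6 - 6 * \<delta>)\<bar> < \<bar>s\<bar>"
    by linarith
  then have "(\<eta> * (12 - 12 * \<delta>\<^sup>2) - (6 - 6 * \<delta>))\<^sup>2 < s\<^sup>2"
    by (metis abs_ge_zero pos2 power2_abs power_strict_mono)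
  \<comment> \<open>The difference of the two squares factors in this way, since the terms free of
    \<open>\<eta>\<close> add up to \<open>35 * (1 - \<delta>\<^sup>2)\<close>. The bound 35/36 puts
    the root in \<open>\<rho>\<close> below 1/6.\<close>
  then have "(1 - \<delta>\<^sup>2) * (35 - 36 * (4 * (1 - \<delta>) * q)) < 0"
    unfolding s2 q_def by (simp add: power2_eq_square algebra_simps)
  then have q_gt: "35 / 36 < 4 * (1 - \<delta>) * q"
    using \<open>\<delta>\<^sup>2 < 1\<close> by (simp add: mult_less_0_iff)
  then have "0 < (1 - \<delta>) * q"
    by (simp add: algebra_simps)
  then have q_pos: "0 < q"
    using assms(12) by (simp add: zero_less_mult_iff)
  \<comment> \<open>Completing the square in \<open>\<eta>\<close> shows that the radicand of
    \<open>\<rho>\<close> is nonnegative.\<close>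
  have "4 * (1 - \<delta>) * q \<le> 4 * (1 + \<delta>) * q"
    using q_pos \<delta>_ge by (intro mult_right_mono) auto
  also have "\<dots> = 1 - (1 - 2 * \<eta> * (1 + \<delta>))\<^sup>2"
    by (simp add: q_def power2_eq_square algebra_simps)
  finally have q_le: "4 * (1 - \<delta>) * q \<le> 1"
    using zero_le_power2[of "1 - 2 * \<eta> * (1 + \<delta>)"] by linarith
  have \<rho>_ge: "0 \<le> \<rho>" and \<rho>2: "\<rho>\<^sup>2 = 4 * (1 - 4 * (1 - \<delta>) * q)"
    using q_le by (simp_all add: \<rho>_eq power_mult_distrib)
  have "\<rho>\<^sup>2 < (1 / 3)\<^sup>2"
    using q_gt unfolding \<rho>2 by (simp add: power2_eq_square)
  then have \<rho>_less: "\<rho> < 1 / 3"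
    by (rule power2_less_imp_less) simp
  have \<kappa>_eq: "\<kappa> = \<rho> ^ n + 2 * \<rho> * (\<Sum>i<n. \<rho> ^ i)"
  proof -
    have sum_eq: "(\<Sum>i<n. \<rho> ^ i) = (1 - \<rho> ^ n) / (1 - \<rho>)"
      using \<rho>_less by (simp add: sum_gp_strict)
    show ?thesis
      unfolding sum_eq assms(16) using \<rho>_less by (simp add: field_simps)
  qed
  have "\<rho> ^ n < 1"
    using \<rho>_ge \<rho>_less \<open>1 \<le> n\<close> by (simp add: power_less_one_iff)
  \<comment> \<open>Clearing the denominator \<open>1 - \<rho>\<close>, the claim
    \<open>\<kappa> < 1\<close> becomes this inequality.\<close>
  then have "\<rho> ^ n * (1 - 3 * \<rho>) < 1 * (1 - 3 * \<rho>)"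
    using \<rho>_less by (intro mult_strict_right_mono) auto
  then have "\<kappa> < 1"
    using \<rho>_less unfolding assms(16) by (simp add: field_simps)
  interpret svrg_rip A Xs H r b \<eta> \<delta> \<rho>
    using assms(3,4,6,9) rip \<rho>_ge \<rho>2 q_pos by unfold_locales (auto simp: q_def)
  show ?thesis
    using \<open>\<kappa> < 1\<close> expectation_svrg_arm_le[OF assms(10) \<kappa>_eq] assms(7) by simp
qed

end
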